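(* Let $0<s<1$ and let $u(x,t)\in(C^2(\mathbb{R}^n)\cap\tilde{\mathcal{L}}_{2s})\times C^1(\mathbb{R})$. Let $t\in\mathbb{R}$ be fixed and assume that $u(\cdot,t)$ attains its maximum over $\mathbb{R}^n$ at a point $\tilde x\in\mathbb{R}^n$. Let $$C_0:=\frac{1}{\int_{B_1^c(0)}\frac{1}{|y|^{n+2s}}\,dy}>0.$$ Then for any $r>0$, $$\frac{C_0}{C_{n,s}}\,r^{2s}\big\{(-\Delta)^su(\tilde x,t)-\Delta u(\tilde x,t)\big\}+C_0\,r^{2s}\int_{B_r^c(\tilde x)}\frac{u(y,t)}{|\tilde x-y|^{n+2s}}\,dy\ \ge\ u(\tilde x,t),$$ and $$C_0\,r^{2s}\int_{B_r^c(\tilde x)}\frac{1}{|\tilde x-y|^{n+2s}}\,dy=1.$$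
   Context: $B_r^c(x)$ denotes the complement in $\mathbb{R}^n$ of the ball $B_r(x)$ of radius $r$ centered at $x$. The notation $u\in(C^2(\mathbb{R}^n)\cap\tilde{\mathcal{L}}_{2s})\times C^1(\mathbb{R})$ means that, as a function of $x$ (for each $t$), $u$ is in $C^2(\mathbb{R}^n)\cap\tilde{\mathcal{L}}_{2s}$ and, as a function of $t$ (for each $x$), it is in $C^1(\mathbb{R})$, where $$\tilde{\mathcal{L}}_{2s}=\Big\{u(\cdot,t)\in L^1_{loc}(\mathbb{R}^n)\ \Big|\ \int_{\mathbb{R}^n}\frac{|u(x,t)|}{1+|x|^{n+2s}}\,dx<+\infty\Big\}.$$ For each fixed $t$, $$(-\Delta)^s u(x,t)=C_{n,s}\,\mathrm{P.V.}\int_{\mathbb{R}^n}\frac{u(x,t)-u(y,t)}{|x-y|^{n+2s}}\,dy=C_{n,s}\lim_{\epsilon\to0}\int_{\mathbb{R}^n\setminus B_\epsilon(x)}\frac{u(x,t)-u(y,t)}{|x-y|^{n+2s}}\,dy,$$ with $C_{n,s}>0$ the usual normalization constant (the same constant appears in the claim), and $\Delta$ is the classical Laplacian in $x$. *)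

theory Defs
  imports "HOL-Analysis.Analysis"
begin

definition C2_function :: "(real ^ 'n \<Rightarrow> real) \<Rightarrow> bool" where
  "C2_function f \<longleftrightarrow>
    (\<exists>(f1 :: real ^ 'n \<Rightarrow> (real ^ 'n) \<Rightarrow>\<^sub>L real)
      (f2 :: real ^ 'n \<Rightarrow> (real ^ 'n) \<Rightarrow>\<^sub>L ((real ^ 'n) \<Rightarrow>\<^sub>L real)).
      (\<forall>x. (f has_derivative blinfun_apply (f1 x)) (at x)) \<and>
      (\<forall>x. (f1 has_derivative blinfun_apply (f2 x)) (at x)) \<and>
      continuous_on UNIV f2)"

definition partial_deriv :: "'n \<Rightarrow> (real ^ 'n \<Rightarrow> real) \<Rightarrow> real ^ 'n \<Rightarrow> real" where
  "partial_deriv i f x = deriv (\<lambda>h. f (x + h *\<^sub>R axis i 1)) 0"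

definition laplacian :: "(real ^ 'n \<Rightarrow> real) \<Rightarrow> real ^ 'n \<Rightarrow> real" where
  "laplacian f x = (\<Sum>i\<in>UNIV. partial_deriv i (partial_deriv i f) x)"

definition L1_loc :: "(real ^ 'n \<Rightarrow> real) \<Rightarrow> bool" where
  "L1_loc f \<longleftrightarrow> (\<forall>K. compact K \<longrightarrow> set_integrable lebesgue K f)"

text \<open>The space $\tilde{\mathcal{L}}_{2s}$, for a single time slice.\<close>

definition L_tilde :: "real \<Rightarrow> (real ^ 'n \<Rightarrow> real) set" where
  "L_tilde s = {f. L1_loc f \<and>
     (\<integral>\<^sup>+x. ennreal (\<bar>f x\<bar> / (1 + norm x powr (real CARD('n) + 2 * s))) \<partial>lebesgue) < \<infinity>}"

text \<open>
  The usual normalization constant $C_{n,s} = 4^s \Gamma(n/2+s) / (\pi^{n/2} |\Gamma(-s)|)$,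
  for which the operator below has Fourier symbol $|\xi|^{2s}$.
\<close>

definition frac_laplacian_const :: "nat \<Rightarrow> real \<Rightarrow> real" where
  "frac_laplacian_const n s =
     4 powr s * Gamma (real n / 2 + s) / (pi powr (real n / 2) * \<bar>Gamma (- s)\<bar>)"

text \<open>
  The operator $(-\Delta)^s$. The value is meaningful where the principal value exists,
  in particular everywhere for \<open>f\<close> in $C^2(\mathbb{R}^n) \cap \tilde{\mathcal{L}}_{2s}$ and $0<s<1$.
\<close>

definition frac_laplacian :: "real \<Rightarrow> (real ^ 'n \<Rightarrow> real) \<Rightarrow> real ^ 'n \<Rightarrow> real" where
  "frac_laplacian s f x = frac_laplacian_const CARD('n) s *
     Lim (at_right 0) (\<lambda>\<epsilon>. LINT y : - ball x \<epsilon> | lebesgue.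
       (f x - f y) / norm (x - y) powr (real CARD('n) + 2 * s))"

end

theory Submission
  imports Defs
begin

text \<open>
  Write \<open>f = u(\<cdot>, t)\<close>, \<open>M = f xt\<close> and \<open>p = n + 2 s\<close>. Since \<open>M\<close> is the maximum of \<open>f\<close>, the integrand
  \<open>h y = (M - f y) / |xt - y| powr p\<close> of the fractional Laplacian is nonnegative. Discarding the
  part of its integral over the ball \<open>ball xt r\<close> therefore only decreases it:
  \<open>frac_laplacian s f xt / C \<ge> M * J - (\<integral>y \<in> - ball xt r. f y / |xt - y| powr p)\<close>, where \<open>C\<close> is the
  normalization constant and \<open>J\<close> is the integral of the kernel over \<open>- ball xt r\<close>. Scaling gives
  \<open>C0 * r powr (2 s) * J = 1\<close> (\<open>kernel_tail_scaling\<close>), so multiplying by \<open>C0 * r powr (2 s)\<close> gives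
  the inequality without the term in the classical Laplacian. That term only helps, because
  \<open>laplacian f xt \<le> 0\<close> at a maximum (\<open>laplacian_nonpos_at_max\<close>) and \<open>C > 0\<close>.

  The argument needs the principal value to exist, since \<open>Lim\<close> carries no information
  otherwise. At a maximum it is even an ordinary Lebesgue integral: \<open>h\<close> is integrable over the whole
  space (\<open>integrable_frac_laplacian_integrand_at_max\<close>). Near \<open>xt\<close> the gradient
  vanishes at \<open>xt\<close> and is differentiable there, hence \<open>M - f y \<le> K |xt - y|^2\<close>
  (\<open>quadratic_bound_at_max\<close>), and \<open>|xt - y|^(2 - p)\<close> is integrable at the origin because
  \<open>s < 1\<close>. Away from \<open>xt\<close>, the constant part is integrable because \<open>s > 0\<close>, and \<open>f\<close> itself by its
  membership in \<open>L_tilde s\<close>. The two power-type integrals are estimated on dyadic balls,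
  which avoids polar coordinates.
\<close>

section \<open>Integrability by countable coverings with balls\<close>

text \<open>
  The function \<open>|g|\<close> is dominated on \<open>A\<close> by the sum of \<open>c k\<close> times the indicator of the ball of radius
  \<open>\<rho> k\<close>, whose integral is the given series times the volume of the unit ball. Whole balls
  instead of annuli only cost a constant factor, and their volumes follow from scaling.
\<close>

lemma set_integrable_lebesgue_covering:
  fixes g :: "'a::euclidean_space \<Rightarrow> real" and c \<rho> :: "nat \<Rightarrow> real"
  assumes A: "A \<in> sets borel" and g: "g \<in> borel_measurable borel"
    and nonneg: "\<And>k. 0 \<le> c k" "\<And>k. 0 \<le> \<rho> k"
    and cover: "\<And>y. y \<in> A \<Longrightarrow> \<exists>k. dist x y < \<rho> k \<and> \<bar>g y\<bar> \<le> c k"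
    and summable: "summable (\<lambda>k. c k * \<rho> k ^ DIM('a))"
  shows "set_integrable lebesgue A g"
proof -
  note [measurable] = A g
  define v where "v = measure lborel (ball (0::'a) 1)"
  have [measurable]: "ball x (\<rho> k) \<in> sets borel" for k by simp
  have v: "0 \<le> v" by (simp add: v_def)
  have ball: "emeasure lborel (ball x (\<rho> k)) = ennreal (v * \<rho> k ^ DIM('a))" for k
    using content_ball_conv_unit_ball[OF nonneg(2)[of k], of x] emeasure_lborel_ball_finite[of x "\<rho> k"]
    by (simp add: emeasure_eq_ennreal_measure v_def mult.commute)
  have bound: "ennreal (norm (indicator A y *\<^sub>R g y))
      \<le> (\<Sum>k. ennreal (c k) * indicator (ball x (\<rho> k)) y)" for y
  proof (cases "y \<in> A")
    case True
    then obtain k where k: "dist x y < \<rho> k" "\<bar>g y\<bar> \<le> c k" using cover by blast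
    define G where "G k = ennreal (c k) * indicator (ball x (\<rho> k)) y" for k
    have "ennreal (norm (indicator A y *\<^sub>R g y)) \<le> G k"
      using k True by (simp add: G_def ennreal_leI)
    also have "G k \<le> suminf G"
      using sum_le_suminf[of G "{k}"] by simp
    finally show ?thesis unfolding G_def .
  qed simp
  have "(\<integral>\<^sup>+y. ennreal (norm (indicator A y *\<^sub>R g y)) \<partial>lborel)
      \<le> (\<integral>\<^sup>+y. (\<Sum>k. ennreal (c k) * indicator (ball x (\<rho> k)) y) \<partial>lborel)"
    by (intro nn_integral_mono bound)
  also have "\<dots> = (\<Sum>k. ennreal (c k * (v * \<rho> k ^ DIM('a))))"
    by (subst nn_integral_suminf) (auto simp: nn_integral_cmult_indicator ball ennreal_mult' nonneg)
  also have "\<dots> < \<infinity>"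
  proof -
    have "summable (\<lambda>k. c k * (v * \<rho> k ^ DIM('a)))"
      using summable_mult[OF summable, of v] by (simp only: mult.left_commute)
    then have "(\<Sum>k. ennreal (c k * (v * \<rho> k ^ DIM('a)))) \<noteq> top"
      using nonneg v by (intro ennreal_suminf_neq_top) auto
    then show ?thesis by (simp add: less_top)
  qed
  finally have "integrable lborel (\<lambda>y. indicator A y *\<^sub>R g y)"
    by (intro integrableI_bounded) auto
  then show ?thesis
    unfolding set_integrable_def by (subst integrable_completion) auto
qed

section \<open>The kernel of the fractional Laplacian\<close>

lemma ex_dyadic_bracket:
  fixes z :: real
  assumes "1 \<le> z"
  obtains k :: nat where "2 ^ k \<le> z" "z < 2 ^ Suc k"
proof -
  define k where "k = nat \<lfloor>log 2 z\<rfloor>"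
  have "0 \<le> log 2 z" using assms by simp
  then have "real k \<le> log 2 z" "log 2 z < real (Suc k)" by (auto simp: k_def) linarith+
  then have "2 powr real k \<le> z" "z < 2 powr real (Suc k)"
    using assms by (simp_all add: le_log_iff log_less_iff)
  then show ?thesis using that[of k] by (simp only: powr_realpow zero_less_numeral)
qed

lemma power_powr:
  fixes a :: real
  assumes "0 < a"
  shows "(a ^ k) powr p = (a powr p) ^ k"
  using assms by (induction k) (simp_all add: powr_mult)

text \<open>
  On the dyadic annulus \<open>r 2^k \<le> |x - y| < r 2^(k+1)\<close> the kernel is at most \<open>(r 2^k) powr (- p)\<close>, so
  the covering series is geometric with ratio \<open>2 powr (n - p)\<close>, where \<open>n\<close> is the dimension.
\<close>

lemma set_integrable_kernel_tail:
  fixes x :: "'a::euclidean_space"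
  assumes r: "0 < r" and p: "real DIM('a) < p"
  shows "set_integrable lebesgue (- ball x r) (\<lambda>y. 1 / norm (x - y) powr p)"
proof (rule set_integrable_lebesgue_covering[where x = x
      and c = "\<lambda>k. 1 / (r * 2 ^ k) powr p" and \<rho> = "\<lambda>k. r * 2 ^ Suc k"])
  fix y assume "y \<in> - ball x r"
  then have y: "r \<le> norm (x - y)" by (simp add: dist_norm)
  then have "1 \<le> norm (x - y) / r" using r by simp
  from ex_dyadic_bracket[OF this] obtain k :: nat
    where k: "2 ^ k \<le> norm (x - y) / r" "norm (x - y) / r < 2 ^ Suc k" .
  have k1: "r * 2 ^ k \<le> norm (x - y)" "norm (x - y) < r * 2 ^ Suc k" 
    using k r by (simp_all add: field_simps)
  have "(r * 2 ^ k) powr p \<le> norm (x - y) powr p"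
    using k1 r p by (intro powr_mono2) auto
  then have "\<bar>1 / norm (x - y) powr p\<bar> \<le> 1 / (r * 2 ^ k) powr p"
    using r by (simp add: frac_le)
  then show "\<exists>k. dist x y < r * 2 ^ Suc k \<and> \<bar>1 / norm (x - y) powr p\<bar> \<le> 1 / (r * 2 ^ k) powr p"
    using k1 by (auto simp: dist_norm)
next
  have "1 / (r * 2 ^ k) powr p * (r * 2 ^ Suc k) ^ DIM('a)
      = (2 * r) ^ DIM('a) / r powr p * (2 ^ DIM('a) / 2 powr p) ^ k" for k
    using r by (simp add: powr_mult power_powr power_divide power_mult_distrib power_commutes
        flip: power_mult)
  moreover have "2 ^ DIM('a) / 2 powr p < 1"
    using powr_less_mono[OF p, of 2] by (simp add: powr_realpow)
  ultimately show "summable (\<lambda>k. 1 / (r * 2 ^ k) powr p * (r * 2 ^ Suc k) ^ DIM('a))"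
    by (auto intro!: summable_mult summable_geometric)
qed (use r in auto)

text \<open>
  On the dyadic annulus \<open>r / 2^(k+1) < |x - y| \<le> r / 2^k\<close> the covering series is geometric with ratio
  \<open>2 powr (p - n - 2)\<close>. Bounding numerator and denominator separately covers both signs
  of \<open>2 - p\<close>. The center falls into no annulus, but the quotient is \<open>0\<close> there.
\<close>

lemma set_integrable_kernel_core:
  fixes x :: "'a::euclidean_space"
  assumes r: "0 < r" and p: "0 \<le> p" "p < real DIM('a) + 2"
  shows "set_integrable lebesgue (ball x r) (\<lambda>y. (norm (x - y))\<^sup>2 / norm (x - y) powr p)"
proof (rule set_integrable_lebesgue_covering[where x = x
      and c = "\<lambda>k. (r / 2 ^ k)\<^sup>2 / (r / 2 ^ Suc k) powr p" and \<rho> = "\<lambda>k. 2 * r / 2 ^ k"])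
  fix y assume y: "y \<in> ball x r"
  show "\<exists>k. dist x y < 2 * r / 2 ^ k \<and> \<bar>(norm (x - y))\<^sup>2 / norm (x - y) powr p\<bar>
      \<le> (r / 2 ^ k)\<^sup>2 / (r / 2 ^ Suc k) powr p"
  proof (cases "y = x")
    case True
    then show ?thesis using r by (intro exI[of _ 0]) auto
  next
    case False
    then have n: "0 < norm (x - y)" by simp
    have "1 \<le> r / norm (x - y)" using n y by (simp add: dist_norm)
    from ex_dyadic_bracket[OF this] obtain k :: nat
      where k: "2 ^ k \<le> r / norm (x - y)" "r / norm (x - y) < 2 ^ Suc k" .
    have k1: "norm (x - y) \<le> r / 2 ^ k" "r / 2 ^ Suc k < norm (x - y)"
      using k n by (simp_all add: field_simps)
    have "(norm (x - y))\<^sup>2 \<le> (r / 2 ^ k)\<^sup>2"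
      using k1 by (intro power_mono) auto
    moreover have "(r / 2 ^ Suc k) powr p \<le> norm (x - y) powr p"
      using k1 r p by (intro powr_mono2) auto
    ultimately have "(norm (x - y))\<^sup>2 / norm (x - y) powr p \<le> (r / 2 ^ k)\<^sup>2 / (r / 2 ^ Suc k) powr p"
      using r by (intro frac_le) auto
    moreover have "norm (x - y) < 2 * r / 2 ^ k"
    proof -
      have "0 < r / 2 ^ k" using r by simp
      then show ?thesis using k1 by simp
    qed
    ultimately show ?thesis by (auto simp: dist_norm)
  qed
next
  have "(r / 2 ^ k)\<^sup>2 / (r / 2 ^ Suc k) powr p * (2 * r / 2 ^ k) ^ DIM('a)
      = r\<^sup>2 * (2 * r) ^ DIM('a) * 2 powr p / r powr p * (2 powr p / 2 ^ (DIM('a) + 2)) ^ k" for k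
  proof -
    have "(r / 2 ^ Suc k) powr p = r powr p / (2 powr p * (2 powr p) ^ k)"
      using r by (simp add: powr_divide powr_mult power_powr)
    moreover have "(2 ^ (DIM('a) + 2)) ^ k = ((2 ^ k) ^ DIM('a) * (2 ^ k)\<^sup>2 :: real)"
      by (simp only: power_add power_mult_distrib flip: power_mult) (simp only: mult.commute)
    ultimately show ?thesis by (simp only: power_divide) (simp add: mult_ac)
  qed
  moreover have "2 powr p / 2 ^ (DIM('a) + 2) < 1"
    using powr_less_mono[OF p(2), of 2] by (simp add: powr_add powr_realpow power_add)
  ultimately show "summable (\<lambda>k. (r / 2 ^ k)\<^sup>2 / (r / 2 ^ Suc k) powr p * (2 * r / 2 ^ k) ^ DIM('a))"
    by (auto intro!: summable_mult summable_geometric)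
qed (use r in auto)

text \<open>
  The substitution \<open>y = x + r z\<close>, carried out for the Borel measure and transferred to its
  completion.
\<close>

lemma kernel_tail_scaling:
  fixes x :: "'a::euclidean_space"
  assumes r: "0 < r"
  shows "r powr (p - real DIM('a)) * (LINT y : - ball x r | lebesgue. 1 / norm (x - y) powr p)
       = (LINT y : - ball (0::'a) 1 | lebesgue. 1 / norm y powr p)"
proof -
  define F where "F y = indicator (- ball x r) y *\<^sub>R (1 / norm (x - y) powr p)" for y
  have F[measurable]: "F \<in> borel_measurable borel" unfolding F_def by measurable
  have "integral\<^sup>L lebesgue F = integral\<^sup>L lborel F"
    by (rule integral_completion) simp
  also have "\<dots> = integral\<^sup>L (density (distr lborel borel (\<lambda>y. x + r *\<^sub>R y)) (\<lambda>_. ennreal (r ^ DIM('a)))) F"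
    using lborel_affine[of r x] r by simp
  also have "\<dots> = (\<integral>y. r ^ DIM('a) * F (x + r *\<^sub>R y) \<partial>lborel)"
    using r by (subst integral_density) (auto simp: integral_distr)
  also have "(\<lambda>y. r ^ DIM('a) * F (x + r *\<^sub>R y))
      = (\<lambda>y. r powr (real DIM('a) - p) * (indicator (- ball 0 1) y *\<^sub>R (1 / norm y powr p)))"
    using r by (auto simp: F_def indicator_def dist_norm powr_mult powr_diff powr_realpow fun_eq_iff)
  also have "(\<integral>y. r powr (real DIM('a) - p) * (indicator (- ball (0::'a) 1) y *\<^sub>R (1 / norm y powr p)) \<partial>lborel)
      = r powr (real DIM('a) - p) * (\<integral>y. indicator (- ball (0::'a) 1) y *\<^sub>R (1 / norm y powr p) \<partial>lebesgue)"
    by (subst integral_mult_right_zero, subst integral_completion) auto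
  finally show ?thesis
    using r by (simp add: set_lebesgue_integral_def F_def powr_diff)
qed

text \<open>
  If the integral vanished, the complement of the unit ball, where the kernel is positive, would be a
  null set, and the whole space would have finite measure.
\<close>

lemma kernel_tail_integral_pos:
  assumes p: "real DIM('a::euclidean_space) < p"
  shows "0 < (LINT y : - ball (0::'a) 1 | lebesgue. 1 / norm y powr p)"
proof -
  define F where "F y = indicator (- ball (0::'a) 1) y *\<^sub>R (1 / norm y powr p)" for y
  have int: "integrable lebesgue F"
    using set_integrable_kernel_tail[of 1 p "0::'a"] p by (simp add: set_integrable_def F_def[abs_def])
  have nonneg: "0 \<le> F y" for y by (simp add: F_def)
  have "integral\<^sup>L lebesgue F \<noteq> 0"
  proof
    assume "integral\<^sup>L lebesgue F = 0"
    then have "AE y in lebesgue. F y = 0"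
      using int nonneg by (simp add: integral_nonneg_eq_0_iff_AE)
    then have "AE y in lebesgue. y \<in> ball (0::'a) 1"
      by eventually_elim (auto simp: F_def indicator_def split: if_splits)
    then have "emeasure lebesgue (- ball (0::'a) 1) = 0"
      by (subst (asm) AE_iff_measurable[where N = "- ball 0 1"]) auto
    moreover have "emeasure lebesgue (UNIV::'a set) \<le> emeasure lebesgue (- ball (0::'a) 1) + emeasure lebesgue (ball (0::'a) 1)"
      using emeasure_subadditive[of "- ball (0::'a) 1" lebesgue "ball 0 1"] by simp
    ultimately show False
      using emeasure_lborel_ball_finite[of "0::'a" 1] by (simp add: top_unique)
  qed
  moreover have "0 \<le> integral\<^sup>L lebesgue F" using nonneg by (rule Bochner_Integration.integral_nonneg)
  ultimately have "0 < integral\<^sup>L lebesgue F" by linarith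
  then show ?thesis unfolding set_lebesgue_integral_def F_def[abs_def] .
qed

text \<open>
  Outside a ball around \<open>x\<close>, the weight \<open>1 / |x - y| powr p\<close> is at most a constant times the
  weight \<open>1 / (1 + |y| powr p)\<close>. The constant comes from \<open>1 \<le> |x - y| / r\<close> and
  \<open>|y| \<le> |x - y| + |x| \<le> (1 + |x| / r) |x - y|\<close>.
\<close>

lemma set_integrable_far_field:
  fixes x :: "'a::euclidean_space" and f :: "'a \<Rightarrow> real"
  assumes f: "f \<in> borel_measurable borel" and p: "0 \<le> p" and r: "0 < r"
    and fin: "(\<integral>\<^sup>+y. ennreal (\<bar>f y\<bar> / (1 + norm y powr p)) \<partial>lebesgue) < \<infinity>"
  shows "set_integrable lebesgue (- ball x r) (\<lambda>y. f y / norm (x - y) powr p)"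
proof -
  note [measurable] = f
  define K where "K = (1 / r) powr p + (1 + norm x / r) powr p"
  have meas: "(\<lambda>y. f y / (1 + norm y powr p)) \<in> borel_measurable lborel" by measurable
  have "integrable lebesgue (\<lambda>y. f y / (1 + norm y powr p))"
    using fin by (intro integrableI_bounded measurable_completion[OF meas]) (simp add: abs_divide)
  then have "integrable lebesgue (\<lambda>y. indicator (- ball x r) y *\<^sub>R (K * (f y / (1 + norm y powr p))))"
    by (intro integrable_mult_indicator integrable_mult_right) auto
  then have "set_integrable lebesgue (- ball x r) (\<lambda>y. K * (f y / (1 + norm y powr p)))"
    by (simp add: set_integrable_def)
  then show ?thesis
  proof (rule set_integrable_bound)
    show "set_borel_measurable lebesgue (- ball x r) (\<lambda>y. f y / norm (x - y) powr p)"
      unfolding set_borel_measurable_def by (intro measurable_completion) measurable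
    have "norm (f y / norm (x - y) powr p) \<le> norm (K * (f y / (1 + norm y powr p)))"
      if "y \<in> - ball x r" for y
    proof -
      have d: "r \<le> norm (x - y)" using that by (simp add: dist_norm)
      have "1 \<le> (1 / r * norm (x - y)) powr p"
        using d r p by (intro ge_one_powr_ge_zero) (auto simp: field_simps)
      moreover have "norm y powr p \<le> ((1 + norm x / r) * norm (x - y)) powr p"
      proof (rule powr_mono2)
        have "norm y \<le> norm (x - y) + norm x" by norm
        also have "norm x \<le> norm x / r * norm (x - y)"
          using d r mult_left_mono[OF d, of "norm x"] by (simp add: field_simps)
        finally show "norm y \<le> (1 + norm x / r) * norm (x - y)" by (simp add: algebra_simps)
      qed (use p in auto)
      ultimately have "1 + norm y powr p \<le> K * norm (x - y) powr p"
        using r by (subst (asm) (1 2) powr_mult) (auto simp: K_def algebra_simps)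
      moreover have "x \<noteq> y" using d r by auto
      ultimately have "1 / norm (x - y) powr p \<le> K / (1 + norm y powr p)"
        by (simp add: divide_simps add_pos_nonneg mult.commute)
      from mult_left_mono[OF this, of "\<bar>f y\<bar>"]
      show ?thesis using r by (simp add: abs_mult K_def add_pos_nonneg mult.commute)
    qed
    then show "AE y in lebesgue. y \<in> - ball x r \<longrightarrow>
        norm (f y / norm (x - y) powr p) \<le> norm (K * (f y / (1 + norm y powr p)))" by simp
  qed
qed

lemma set_integrable_near_field:
  fixes x :: "'a::euclidean_space" and g :: "'a \<Rightarrow> real"
  assumes g: "g \<in> borel_measurable borel" and r: "0 < r" and p: "0 \<le> p" "p < real DIM('a) + 2"
    and bound: "\<And>y. y \<in> ball x r \<Longrightarrow> \<bar>g y\<bar> \<le> K * (norm (x - y))\<^sup>2"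
  shows "set_integrable lebesgue (ball x r) (\<lambda>y. g y / norm (x - y) powr p)"
proof -
  note [measurable] = g
  have [measurable]: "ball x r \<in> sets borel" by simp
  have "set_integrable lebesgue (ball x r) (\<lambda>y. K * ((norm (x - y))\<^sup>2 / norm (x - y) powr p))"
    by (intro set_integrable_mult_right set_integrable_kernel_core r p)
  then show ?thesis
  proof (rule set_integrable_bound)
    show "set_borel_measurable lebesgue (ball x r) (\<lambda>y. g y / norm (x - y) powr p)"
      unfolding set_borel_measurable_def by (intro measurable_completion) measurable
    have "norm (g y / norm (x - y) powr p) \<le> norm (K * ((norm (x - y))\<^sup>2 / norm (x - y) powr p))"
      if "y \<in> ball x r" for y
    proof -
      have "\<bar>g y\<bar> / norm (x - y) powr p \<le> K * (norm (x - y))\<^sup>2 / norm (x - y) powr p"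
        using bound[OF that] by (rule divide_right_mono) simp
      from order_trans[OF this abs_ge_self] show ?thesis by simp
    qed
    then show "AE y in lebesgue. y \<in> ball x r \<longrightarrow>
        norm (g y / norm (x - y) powr p) \<le> norm (K * ((norm (x - y))\<^sup>2 / norm (x - y) powr p))"
      by simp
  qed
qed

section \<open>First and second order conditions at a maximum\<close>

text \<open>
  The derivative vanishes at the maximum point \<open>x\<close> and is itself differentiable there, so it is
  at most a constant times the distance to \<open>x\<close>; the mean value inequality turns this into a quadratic bound.
\<close>

lemma quadratic_bound_at_max:
  fixes f :: "'a::real_normed_vector \<Rightarrow> real" and f1 :: "'a \<Rightarrow> 'a \<Rightarrow>\<^sub>L real"
  assumes f1: "\<And>x. (f has_derivative blinfun_apply (f1 x)) (at x)"
    and f2: "(f1 has_derivative D) (at x)"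
    and max: "\<And>y. f y \<le> f x"
  obtains K \<delta> where "0 \<le> K" "0 < \<delta>" "\<And>y. y \<in> ball x \<delta> \<Longrightarrow> f x - f y \<le> K * (norm (x - y))\<^sup>2"
proof -
  have "blinfun_apply (f1 x) = (\<lambda>v. 0)"
    using differential_zero_maxmin[of x UNIV f, OF _ _ f1] max by auto
  then have zero: "f1 x = 0" by (intro blinfun_eqI) simp
  interpret D: bounded_linear D using f2 by (rule has_derivative_bounded_linear)
  obtain B where B: "0 \<le> B" "\<And>v. norm (D v) \<le> norm v * B" using D.nonneg_bounded by blast
  obtain \<delta> where \<delta>: "0 < \<delta>"
    "\<And>y. norm (y - x) < \<delta> \<Longrightarrow> norm (f1 y - f1 x - D (y - x)) \<le> 1 * norm (y - x)"
    using f2 unfolding has_derivative_at_alt by (meson zero_less_one)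
  have grad: "norm (f1 y) \<le> (B + 1) * norm (x - y)" if "y \<in> ball x \<delta>" for y
  proof -
    have "norm (f1 y - D (y - x)) \<le> norm (y - x)"
      using \<delta>(2)[of y] that zero by (simp add: dist_norm norm_minus_commute)
    moreover have "norm (f1 y) \<le> norm (f1 y - D (y - x)) + norm (D (y - x))" by (metis diff_add_cancel norm_triangle_ineq)
    ultimately show ?thesis using B(2)[of "y - x"] by (simp add: algebra_simps norm_minus_commute)
  qed
  have "f x - f y \<le> (B + 1) * (norm (x - y))\<^sup>2" if y: "y \<in> ball x \<delta>" for y
  proof -
    have "norm (f x - f y) \<le> ((B + 1) * norm (x - y)) * norm (x - y)"
    proof (rule differentiable_bound[where S = "cball x (norm (x - y))" and f' = "\<lambda>z. blinfun_apply (f1 z)"])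
      fix z assume z: "z \<in> cball x (norm (x - y))"
      show "(f has_derivative blinfun_apply (f1 z)) (at z within cball x (norm (x - y)))"
        by (rule has_derivative_at_withinI[OF f1])
      have "norm (f1 z) \<le> (B + 1) * norm (x - z)"
        using y z by (intro grad) (auto simp: dist_norm)
      also have "\<dots> \<le> (B + 1) * norm (x - y)"
        using z B by (intro mult_left_mono) (auto simp: dist_norm)
      finally show "onorm (blinfun_apply (f1 z)) \<le> (B + 1) * norm (x - y)"
        by (simp add: norm_blinfun.rep_eq)
    qed (auto simp: dist_norm)
    then show ?thesis by (simp add: power2_eq_square mult.assoc)
  qed
  with B \<delta> show ?thesis using that[of "B + 1" \<delta>] by auto
qed

text \<open>
  If \<open>D\<close> were positive, then \<open>g1\<close>, which vanishes at \<open>a\<close>, would be positive just to the right of \<open>a\<close>,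
  and \<open>g\<close> would increase there.
\<close>

lemma second_derivative_nonpos_at_max:
  fixes g g1 :: "real \<Rightarrow> real"
  assumes g: "\<And>h. (g has_real_derivative g1 h) (at h)"
    and g1: "(g1 has_real_derivative D) (at a)"
    and max: "\<And>h. g h \<le> g a"
  shows "D \<le> 0"
proof (rule ccontr)
  assume "\<not> D \<le> 0"
  then obtain d where d: "0 < d" "\<And>h. 0 < h \<Longrightarrow> h < d \<Longrightarrow> g1 a < g1 (a + h)"
    using DERIV_pos_inc_right[OF g1] by auto
  have zero: "g1 a = 0"
    using DERIV_local_max[OF g zero_less_one] max by blast
  have "g a < g (a + d / 2)"
  proof (rule DERIV_pos_imp_increasing_open[where f = g])
    fix h assume "a < h" "h < a + d / 2"
    then have "0 < g1 h" using d(2)[of "h - a"] zero by simp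
    then show "\<exists>y. (g has_real_derivative y) (at h) \<and> 0 < y" using g by blast
  qed (use d g in \<open>auto intro: DERIV_isCont continuous_at_imp_continuous_on\<close>)
  then show False using max[of "a + d / 2"] by simp
qed

text \<open>
  Each iterated partial derivative is the second derivative of \<open>f\<close> along a coordinate line
  through \<open>x\<close>.
\<close>

lemma laplacian_nonpos_at_max:
  fixes f :: "real ^ 'n \<Rightarrow> real"
  assumes C2: "C2_function f" and max: "\<And>y. f y \<le> f x"
  shows "laplacian f x \<le> 0"
proof -
  from C2 obtain f1 :: "real ^ 'n \<Rightarrow> (real ^ 'n) \<Rightarrow>\<^sub>L real"
    and f2 :: "real ^ 'n \<Rightarrow> (real ^ 'n) \<Rightarrow>\<^sub>L ((real ^ 'n) \<Rightarrow>\<^sub>L real)"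
    where f1: "\<And>x. (f has_derivative blinfun_apply (f1 x)) (at x)"
      and f2: "\<And>x. (f1 has_derivative blinfun_apply (f2 x)) (at x)"
    unfolding C2_function_def by blast
  have "partial_deriv i (partial_deriv i f) x \<le> 0" for i
  proof -
    define e :: "real ^ 'n" where "e = axis i 1"
    have line: "((\<lambda>h. y + h *\<^sub>R e) has_derivative (\<lambda>h. h *\<^sub>R e)) (at h)" for y h
      by (auto intro!: derivative_eq_intros)
    have g: "((\<lambda>h. f (y + h *\<^sub>R e)) has_real_derivative blinfun_apply (f1 (y + h *\<^sub>R e)) e) (at h)" for y h
      by (rule has_derivative_imp_has_field_derivative[OF has_derivative_compose[OF line f1]])
        (simp add: blinfun.scaleR_right)
    have pd: "partial_deriv i f y = blinfun_apply (f1 y) e" for y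
      using DERIV_imp_deriv[OF g[of y 0]] by (simp add: partial_deriv_def e_def)
    have "((\<lambda>h. blinfun_apply (f1 (x + h *\<^sub>R e)) e) has_derivative
        (\<lambda>h. blinfun_apply (blinfun_apply (f2 (x + 0 *\<^sub>R e)) (h *\<^sub>R e)) e)) (at 0)"
      by (rule bounded_linear.has_derivative[OF blinfun.bounded_linear_left
            has_derivative_compose[OF line f2]])
    then have g1: "((\<lambda>h. blinfun_apply (f1 (x + h *\<^sub>R e)) e) has_real_derivative
        blinfun_apply (blinfun_apply (f2 x) e) e) (at 0)"
      by (rule has_derivative_imp_has_field_derivative) (simp add: blinfun.scaleR_right blinfun.scaleR_left)
    have "blinfun_apply (blinfun_apply (f2 x) e) e \<le> 0"
      by (rule second_derivative_nonpos_at_max[OF g g1]) (simp add: max)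
    moreover have "partial_deriv i (partial_deriv i f) x = blinfun_apply (blinfun_apply (f2 x) e) e"
      using DERIV_imp_deriv[OF g1] pd by (simp add: partial_deriv_def[of _ "partial_deriv i f"] flip: e_def)
    ultimately show ?thesis by simp
  qed
  then show ?thesis unfolding laplacian_def by (rule sum_nonpos)
qed

section \<open>The fractional Laplacian at a maximum\<close>

text \<open>
  The only danger is a pole of the Gamma function at \<open>- s\<close>, where it takes the value \<open>0\<close> by
  convention; there is none strictly between \<open>- 1\<close> and \<open>0\<close>.
\<close>

lemma frac_laplacian_const_pos:
  assumes "0 < s" "s < 1"
  shows "0 < frac_laplacian_const n s"
proof -
  have "- s \<notin> \<int>\<^sub>\<le>\<^sub>0"
  proof
    assume "- s \<in> \<int>\<^sub>\<le>\<^sub>0"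
    then obtain k where "- s = - of_nat k" by (elim nonpos_Ints_cases')
    then have "0 < real k" "real k < 1" using assms by auto
    then show False by auto
  qed
  then have "Gamma (- s) \<noteq> 0" by (simp add: Gamma_eq_zero_iff)
  moreover have "0 < Gamma (real n / 2 + s)" using assms by (intro Gamma_real_pos) simp
  ultimately show ?thesis by (simp add: frac_laplacian_const_def)
qed

text \<open>
  The space is split at the radius \<open>\<delta>\<close> within which the quadratic bound at the maximum holds.
\<close>

lemma integrable_frac_laplacian_integrand_at_max:
  fixes f :: "real ^ 'n \<Rightarrow> real"
  assumes s: "0 < s" "s < 1" and C2: "C2_function f" and L: "f \<in> L_tilde s"
    and max: "\<And>y. f y \<le> f x"
  shows "integrable lebesgue (\<lambda>y. (f x - f y) / norm (x - y) powr (real CARD('n) + 2 * s))"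
proof -
  define p where "p = real CARD('n) + 2 * s"
  have p: "0 \<le> p" "real DIM(real ^ 'n) < p" "p < real DIM(real ^ 'n) + 2"
    using s by (auto simp: p_def)
  from C2 obtain f1 :: "real ^ 'n \<Rightarrow> (real ^ 'n) \<Rightarrow>\<^sub>L real"
    and f2 :: "real ^ 'n \<Rightarrow> (real ^ 'n) \<Rightarrow>\<^sub>L ((real ^ 'n) \<Rightarrow>\<^sub>L real)"
    where f1: "\<And>x. (f has_derivative blinfun_apply (f1 x)) (at x)"
      and f2: "\<And>x. (f1 has_derivative blinfun_apply (f2 x)) (at x)"
    unfolding C2_function_def by blast
  have "continuous_on UNIV f"
    using f1 by (auto intro!: continuous_at_imp_continuous_on has_derivative_continuous)
  then have f[measurable]: "f \<in> borel_measurable borel" by (rule borel_measurable_continuous_onI)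
  obtain K \<delta> where K: "0 \<le> K" "0 < \<delta>" "\<And>y. y \<in> ball x \<delta> \<Longrightarrow> f x - f y \<le> K * (norm (x - y))\<^sup>2"
    using quadratic_bound_at_max[OF f1 f2 max] by blast
  have near: "set_integrable lebesgue (ball x \<delta>) (\<lambda>y. (f x - f y) / norm (x - y) powr p)"
    using K p f max by (intro set_integrable_near_field[where K = K]) auto
  have "set_integrable lebesgue (- ball x \<delta>) (\<lambda>y. f x * (1 / norm (x - y) powr p) - f y / norm (x - y) powr p)"
  proof (intro set_integral_diff(1) set_integrable_mult_right)
    show "set_integrable lebesgue (- ball x \<delta>) (\<lambda>y. 1 / norm (x - y) powr p)"
      using K p by (intro set_integrable_kernel_tail) auto
    show "set_integrable lebesgue (- ball x \<delta>) (\<lambda>y. f y / norm (x - y) powr p)"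
      using L K p f by (intro set_integrable_far_field) (auto simp: L_tilde_def p_def)
  qed
  then have far: "set_integrable lebesgue (- ball x \<delta>) (\<lambda>y. (f x - f y) / norm (x - y) powr p)"
    by (simp add: diff_divide_distrib)
  show ?thesis
    using set_integrable_Un[OF near far] by (simp add: set_integrable_def Un_commute p_def Compl_partition)
qed

text \<open>
  Dominated convergence: an absolutely integrable integrand is its own majorant on the
  complements of shrinking balls. Convergence holds even at the center, which these complements
  never reach, since the integrand is \<open>0\<close> there.
\<close>

lemma frac_laplacian_eq_integral:
  fixes f :: "real ^ 'n \<Rightarrow> real"
  assumes int: "integrable lebesgue (\<lambda>y. (f x - f y) / norm (x - y) powr (real CARD('n) + 2 * s))"
  shows "frac_laplacian s f x = frac_laplacian_const CARD('n) s *
    (LINT y | lebesgue. (f x - f y) / norm (x - y) powr (real CARD('n) + 2 * s))"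
proof -
  define h where "h y = (f x - f y) / norm (x - y) powr (real CARD('n) + 2 * s)" for y
  have h: "integrable lebesgue h" using int by (simp add: h_def[abs_def])
  have "((\<lambda>\<epsilon>. LINT y : - ball x \<epsilon> | lebesgue. h y) \<longlongrightarrow> integral\<^sup>L lebesgue h) (at_right 0)"
  proof (rule tendsto_at_right_sequentially[of 0 1])
    fix S :: "nat \<Rightarrow> real" assume S: "\<And>n. 0 < S n" "S \<longlonglongrightarrow> 0"
    show "(\<lambda>n. LINT y : - ball x (S n) | lebesgue. h y) \<longlonglongrightarrow> integral\<^sup>L lebesgue h"
      unfolding set_lebesgue_integral_def
    proof (rule integral_dominated_convergence[where w = "\<lambda>y. norm (h y)"])
      have "(\<lambda>n. indicator (- ball x (S n)) y *\<^sub>R h y) \<longlonglongrightarrow> h y" for y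
      proof (cases "y = x")
        case True
        then show ?thesis by (simp add: h_def)
      next
        case False
        then have "\<forall>\<^sub>F n in sequentially. S n < dist x y"
          using S(2) by (intro order_tendstoD) auto
        then have "\<forall>\<^sub>F n in sequentially. indicator (- ball x (S n)) y *\<^sub>R h y = h y"
          by eventually_elim simp
        then show ?thesis by (rule tendsto_eventually)
      qed
      then show "AE y in lebesgue. (\<lambda>n. indicator (- ball x (S n)) y *\<^sub>R h y) \<longlonglongrightarrow> h y" by simp
      show "(\<lambda>y. indicator (- ball x (S n)) y *\<^sub>R h y) \<in> borel_measurable lebesgue" for n
        by (intro borel_measurable_integrable integrable_mult_indicator h) auto
    qed (use h in \<open>auto simp: indicator_def\<close>)
  qed simp
  then have "Lim (at_right 0) (\<lambda>\<epsilon>. LINT y : - ball x \<epsilon> | lebesgue. h y) = integral\<^sup>L lebesgue h"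
    by (rule tendsto_Lim[OF trivial_limit_at_right_real])
  then show ?thesis by (simp add: frac_laplacian_def h_def[abs_def])
qed

theorem lemma2p2:
  fixes u :: "real ^ 'n \<Rightarrow> real \<Rightarrow> real" and s t C0 :: real and xt :: "real ^ 'n"
  assumes "0 < s" and "s < 1"
    and "\<And>\<tau>. C2_function (\<lambda>x. u x \<tau>)"
    and "\<And>\<tau>. (\<lambda>x. u x \<tau>) \<in> L_tilde s"
    and "\<And>x. (\<lambda>\<tau>. u x \<tau>) C1_differentiable_on UNIV"
    and "\<And>y. u y t \<le> u xt t"
    and "C0 = 1 / (LINT y : - ball (0 :: real ^ 'n) 1 | lebesgue.
                     1 / norm y powr (real CARD('n) + 2 * s))"
  shows "C0 > 0 \<and>
    (\<forall>r>0.
      C0 / frac_laplacian_const CARD('n) s * r powr (2 * s) *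
          (frac_laplacian s (\<lambda>x. u x t) xt - laplacian (\<lambda>x. u x t) xt)
        + C0 * r powr (2 * s) *
          (LINT y : - ball xt r | lebesgue. u y t / norm (xt - y) powr (real CARD('n) + 2 * s))
        \<ge> u xt t \<and>
      C0 * r powr (2 * s) *
          (LINT y : - ball xt r | lebesgue. 1 / norm (xt - y) powr (real CARD('n) + 2 * s)) = 1)"
proof -
  define p where "p = real CARD('n) + 2 * s"
  define f where "f x = u x t" for x
  define C where "C = frac_laplacian_const CARD('n) s"
  define h where "h y = (f xt - f y) / norm (xt - y) powr p" for y
  have p: "real DIM(real ^ 'n) < p" "p - real DIM(real ^ 'n) = 2 * s" using assms(1) by (auto simp: p_def)
  have C: "0 < C" unfolding C_def using assms(1,2) by (rule frac_laplacian_const_pos)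
  have f: "C2_function f" "f \<in> L_tilde s" and max: "\<And>y. f y \<le> f xt"
    using assms(3,4,6) by (simp_all add: f_def[abs_def])
  have h: "integrable lebesgue h"
    using integrable_frac_laplacian_integrand_at_max[OF assms(1,2) f max] by (simp add: h_def[abs_def] p_def)
  then have frac: "frac_laplacian s f xt = C * integral\<^sup>L lebesgue h"
    using frac_laplacian_eq_integral[of f xt s] by (simp add: h_def[abs_def] p_def C_def)
  have h0: "0 \<le> h y" for y using max by (simp add: h_def)
  have I1: "0 < (LINT y : - ball (0 :: real ^ 'n) 1 | lebesgue. 1 / norm y powr p)"
    by (rule kernel_tail_integral_pos[OF p(1)])
  have C0: "C0 = 1 / (LINT y : - ball (0 :: real ^ 'n) 1 | lebesgue. 1 / norm y powr p)"
    using assms(7) by (simp add: p_def)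
  then have C0_pos: "0 < C0" using I1 by simp
  have norm: "C0 * r powr (2 * s) * (LINT y : - ball xt r | lebesgue. 1 / norm (xt - y) powr p) = 1"
    if "0 < r" for r
    using kernel_tail_scaling[OF that, of p xt, unfolded p(2)] I1 by (simp add: C0)
  have ineq: "f xt \<le> C0 / C * r powr (2 * s) * (frac_laplacian s f xt - laplacian f xt)
      + C0 * r powr (2 * s) * (LINT y : - ball xt r | lebesgue. f y / norm (xt - y) powr p)"
    if r: "0 < r" for r
  proof -
    let ?A = "- ball xt r"
    have tail: "set_integrable lebesgue ?A (\<lambda>y. 1 / norm (xt - y) powr p)"
      using r p by (intro set_integrable_kernel_tail)
    have hA: "set_integrable lebesgue ?A h"
      unfolding set_integrable_def using h by (intro integrable_mult_indicator) auto
    have "(LINT y : ?A | lebesgue. f y / norm (xt - y) powr p)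
        = (LINT y : ?A | lebesgue. f xt * (1 / norm (xt - y) powr p) - h y)"
      by (simp add: h_def diff_divide_distrib)
    also have "\<dots> = f xt * (LINT y : ?A | lebesgue. 1 / norm (xt - y) powr p) - (LINT y : ?A | lebesgue. h y)"
      using tail hA by (subst set_integral_diff(2)) (auto simp del: times_divide_eq_right mult_1_right)
    finally have split: "(LINT y : ?A | lebesgue. f y / norm (xt - y) powr p)
      = f xt * (LINT y : ?A | lebesgue. 1 / norm (xt - y) powr p) - (LINT y : ?A | lebesgue. h y)" .
    \<comment> \<open>This is where maximality enters the comparison: \<open>h\<close> is nonnegative on the discarded ball.\<close>
    have "(LINT y : ?A | lebesgue. h y) \<le> integral\<^sup>L lebesgue h"
      unfolding set_lebesgue_integral_def using h hA h0
      by (intro integral_mono) (auto simp: set_integrable_def indicator_def)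
    moreover have "laplacian f xt \<le> 0" by (rule laplacian_nonpos_at_max[OF f(1) max])
    ultimately have "C * (LINT y : ?A | lebesgue. h y) \<le> frac_laplacian s f xt - laplacian f xt"
      using C by (simp add: frac) (smt (verit) mult_left_mono)
    then have "(LINT y : ?A | lebesgue. h y) \<le> (frac_laplacian s f xt - laplacian f xt) / C"
      using C by (simp add: field_simps)
    then have "C0 * r powr (2 * s) * (LINT y : ?A | lebesgue. h y)
        \<le> C0 * r powr (2 * s) * ((frac_laplacian s f xt - laplacian f xt) / C)"
      using C0_pos by (intro mult_left_mono) auto
    moreover have "C0 * r powr (2 * s) * (LINT y : ?A | lebesgue. f y / norm (xt - y) powr p)
        = f xt * (C0 * r powr (2 * s) * (LINT y : ?A | lebesgue. 1 / norm (xt - y) powr p))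
          - C0 * r powr (2 * s) * (LINT y : ?A | lebesgue. h y)"
      unfolding split by (simp only: right_diff_distrib mult_ac)
    ultimately show ?thesis unfolding norm[OF r] by simp
  qed
  show ?thesis
    using C0_pos norm ineq unfolding p_def f_def[abs_def] C_def by blast
qed

end
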